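(* Let $\mathscr{T}=(T_{ijk})\in\mathbb{R}^{3\times3\times3}$ be a nonlinear susceptibility tensor, i.e. a real third-order tensor with $T_{ijk}=T_{ikj}$ for all $i,j,k\in\{1,2,3\}$, and let $\lambda_{\max}(\mathscr{T})$ be the largest C-eigenvalue of $\mathscr{T}$. Let $$d_{\text{eff}}^1=\max\{\mathscr{T}\boldsymbol{b}\boldsymbol{a}\boldsymbol{a}:\ a_1^2+a_2^2=z_1^2+z_2^2=1,\ a_3=0\},\qquad d_{\text{eff}}^2=\max\{\mathscr{T}\boldsymbol{a}\boldsymbol{b}\boldsymbol{b}:\ a_1^2+a_2^2=z_1^2+z_2^2=1,\ a_3=0\},$$ where $\boldsymbol{a}=(a_1,a_2,a_3)^\top$ and $\boldsymbol{b}=(a_2z_1,-a_1z_1,z_2)^\top$ with $a_1,a_2,z_1,z_2\in\mathbb{R}$. Then $$d_{\text{eff}}^1\le\lambda_{\max}(\mathscr{T}),\qquad d_{\text{eff}}^2\le\lambda_{\max}(\mathscr{T}).$$ Moreover, equality does not hold in general: for each of the two inequalities there exists a nonlinear susceptibility tensor $\mathscr{T}$ for which it is strict.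
   Context: For vectors $\boldsymbol{x},\boldsymbol{y},\boldsymbol{w}\in\mathbb{R}^3$, $\mathscr{T}\boldsymbol{x}\boldsymbol{y}\boldsymbol{w}=\sum_{i,j,k=1}^3T_{ijk}x_iy_jw_k$. A nonlinear (second-order) susceptibility tensor is a real $3\times3\times3$ tensor symmetric in its last two indices (a piezoelectric-type tensor). A real number $\lambda$ is a C-eigenvalue of $\mathscr{T}$ if there exist vectors $\boldsymbol{x},\boldsymbol{y}\in\mathbb{R}^3$ with $\boldsymbol{x}^\top\boldsymbol{x}=1$, $\boldsymbol{y}^\top\boldsymbol{y}=1$, $\mathscr{T}\boldsymbol{y}\boldsymbol{y}=\lambda\boldsymbol{x}$ and $\mathscr{T}\boldsymbol{x}\boldsymbol{y}=\lambda\boldsymbol{y}$, where $(\mathscr{T}\boldsymbol{y}\boldsymbol{y})_i=\sum_{j,k=1}^3T_{ijk}y_jy_k$ and $(\mathscr{T}\boldsymbol{x}\boldsymbol{y})_k=\sum_{i,j=1}^3T_{ijk}x_iy_j$. In uniaxial crystals, $\boldsymbol{a}$ (with $a_3=0$) and $\boldsymbol{b}$ are the mutually orthogonal unit polarization vectors of the ordinary and extraordinary light, and $d_{\text{eff}}^1,d_{\text{eff}}^2$ are the largest effective second-harmonic generation (SHG) coefficients. *)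

theory Defs
  imports "HOL-Analysis.Analysis"
begin

text \<open>
  A tensor \<open>T\<close> in \<open>\<real>\<^sup>3 \<otimes> \<real>\<^sup>3 \<otimes> \<real>\<^sup>3\<close> has type \<open>real^3^3^3\<close>, with entry
  \<open>T $ i $ j $ k\<close> for \<open>T\<^sub>i\<^sub>j\<^sub>k\<close>.
\<close>

definition susceptibility_tensor :: "real^3^3^3 \<Rightarrow> bool" where
  "susceptibility_tensor T \<longleftrightarrow> (\<forall>i j k. T $ i $ j $ k = T $ i $ k $ j)"

definition tensor_form :: "real^3^3^3 \<Rightarrow> real^3 \<Rightarrow> real^3 \<Rightarrow> real^3 \<Rightarrow> real" where
  "tensor_form T x y w =
     (\<Sum>i\<in>UNIV. \<Sum>j\<in>UNIV. \<Sum>k\<in>UNIV. T $ i $ j $ k * x $ i * y $ j * w $ k)"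

definition tensor_yy :: "real^3^3^3 \<Rightarrow> real^3 \<Rightarrow> real^3" where
  "tensor_yy T y = (\<chi> i. \<Sum>j\<in>UNIV. \<Sum>k\<in>UNIV. T $ i $ j $ k * y $ j * y $ k)"

definition tensor_xy :: "real^3^3^3 \<Rightarrow> real^3 \<Rightarrow> real^3 \<Rightarrow> real^3" where
  "tensor_xy T x y = (\<chi> k. \<Sum>i\<in>UNIV. \<Sum>j\<in>UNIV. T $ i $ j $ k * x $ i * y $ j)"

definition C_eigenvalue :: "real^3^3^3 \<Rightarrow> real \<Rightarrow> bool" where
  "C_eigenvalue T l \<longleftrightarrow>
     (\<exists>x y. x \<bullet> x = 1 \<and> y \<bullet> y = 1 \<and> tensor_yy T y = l *\<^sub>R x \<and> tensor_xy T x y = l *\<^sub>R y)"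

text \<open>
  The maxima below use \<^const>\<open>Greatest\<close>, so that they denote attained maxima:
  \<^const>\<open>Max\<close> is only meaningful for finite sets, and a supremum need not be attained.
\<close>

definition lambda_max :: "real^3^3^3 \<Rightarrow> real" where
  "lambda_max T = (GREATEST l. C_eigenvalue T l)"

definition extraordinary :: "real^3 \<Rightarrow> real^2 \<Rightarrow> real^3" where
  "extraordinary a z = vector [a $ 2 * z $ 1, - (a $ 1) * z $ 1, z $ 2]"

definition polarization :: "real^3 \<Rightarrow> real^2 \<Rightarrow> bool" where
  "polarization a z \<longleftrightarrow>
     (a $ 1)\<^sup>2 + (a $ 2)\<^sup>2 = 1 \<and> (z $ 1)\<^sup>2 + (z $ 2)\<^sup>2 = 1 \<and> a $ 3 = 0"

definition d_eff1 :: "real^3^3^3 \<Rightarrow> real" where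
  "d_eff1 T = (GREATEST d. d \<in> {tensor_form T (extraordinary a z) a a | a z. polarization a z})"

definition d_eff2 :: "real^3^3^3 \<Rightarrow> real" where
  "d_eff2 T = (GREATEST d. d \<in> {tensor_form T a (extraordinary a z) (extraordinary a z) | a z.
     polarization a z})"

end

theory Submission
  imports Defs
begin

text \<open>
  The largest C-eigenvalue is the maximum of \<open>\<T>xyy\<close> over all pairs of unit vectors
  (\<open>tensor_form_le_lambda_max\<close>), whereas both effective SHG coefficients are maxima of the same
  expression over a smaller family of such pairs: \<open>a\<close> and \<open>b\<close> are unit vectors, with
  \<open>x = b, y = a\<close> for the first coefficient and \<open>x = a, y = b\<close> for the second. This gives the
  two inequalities, once it is known that all the maxima are attained; this follows from
  compactness.

  The variational description of \<open>\<lambda>\<^sub>m\<^sub>a\<^sub>x\<close> has two halves. If \<open>\<lambda>\<close> is a C-eigenvalue with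
  eigenvectors \<open>x, y\<close>, then \<open>\<T>xyy = x \<bullet> \<T>yy = \<lambda>\<close>, so no C-eigenvalue exceeds the maximum.
  Conversely, a pair \<open>(x, y)\<close> at which the maximum \<open>\<lambda>\<close> is attained solves the eigenvalue
  equations. For fixed \<open>y\<close> the form is linear in \<open>x\<close>, and a linear form
  is maximal on the sphere only in the direction of its gradient, so \<open>\<T>yy = \<lambda>x\<close>
  (\<open>linear_form_maximizer\<close>). For fixed \<open>x\<close> it is a quadratic form in \<open>y\<close>, whose matrix is
  symmetric because \<open>T\<^sub>i\<^sub>j\<^sub>k = T\<^sub>i\<^sub>k\<^sub>j\<close>, and a maximizer on the sphere is an eigenvector for the
  maximal value, so \<open>\<T>xy = \<lambda>y\<close> (\<open>quadratic_form_maximizer\<close>).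

  Strictness holds for the tensor with the single nonzero entry \<open>T\<^sub>3\<^sub>3\<^sub>3 = 1\<close>, that is
  \<open>\<T>xyy = x\<^sub>3y\<^sub>3\<^sup>2\<close>. The constraint \<open>a\<^sub>3 = 0\<close> makes both effective coefficients vanish, but
  \<open>x = y = e\<^sub>3\<close> gives the value 1.
\<close>

section \<open>Maximizers on the unit sphere\<close>

text \<open>
  Comparing with the unit vector in the direction of \<open>v\<close> shows \<open>x \<bullet> v \<ge> norm v\<close>, which forces
  equality in the Cauchy-Schwarz inequality, so \<open>v\<close> is a nonnegative multiple of \<open>x\<close>.
\<close>

lemma linear_form_maximizer:
  fixes x v :: "'a::real_inner"
  assumes x: "norm x = 1" and max: "\<And>u. norm u = 1 \<Longrightarrow> u \<bullet> v \<le> x \<bullet> v"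
  shows "v = (x \<bullet> v) *\<^sub>R x"
proof (cases "v = 0")
  case False
  have "sgn v \<bullet> v = norm v"
    using False by (simp add: sgn_div_norm dot_square_norm power2_eq_square)
  then have "norm v \<le> x \<bullet> v"
    using max[of "sgn v"] False by (simp add: norm_sgn)
  then have "x \<bullet> v = norm x * norm v"
    using norm_cauchy_schwarz[of x v] x by simp
  then have "norm x *\<^sub>R v = norm v *\<^sub>R x"
    by (simp only: norm_cauchy_schwarz_eq)
  then show ?thesis
    using x \<open>x \<bullet> v = norm x * norm v\<close> by simp
qed simp

lemma nonneg_quadratic_linear_coeff_zero:
  fixes c p :: real
  assumes "\<And>t. 0 \<le> 2 * t * c + t\<^sup>2 * p"
  shows "c = 0"
proof (rule ccontr)
  assume "c \<noteq> 0"
  define s where "s = \<bar>p\<bar> + 1"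
  have s: "s > 0" "p < s" by (auto simp: s_def)
  \<comment> \<open>A small step against the sign of the slope makes the linear term dominate.\<close>
  have "2 * (- c / s) * c + (- c / s)\<^sup>2 * p = (c / s)\<^sup>2 * (p - 2 * s)"
    using s by (simp add: field_simps power2_eq_square)
  also have "\<dots> < 0"
    using s \<open>c \<noteq> 0\<close> by (intro mult_pos_neg) auto
  finally show False
    using assms[of "- c / s"] by simp
qed

text \<open>
  The quadratic form of \<open>m - A\<close> is nonnegative and vanishes at \<open>y\<close>. Expanding it on the line
  through \<open>y\<close> in any direction \<open>u\<close> shows that its first-order coefficient, twice
  \<open>u \<bullet> (m y - A y)\<close>, is zero; the direction \<open>u = m y - A y\<close> then gives the claim.
\<close>

lemma quadratic_form_maximizer:
  fixes A :: "'a::real_inner \<Rightarrow> 'a"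
  assumes lin: "linear A" and sym: "\<And>u w. u \<bullet> A w = w \<bullet> A u"
    and le: "\<And>u. u \<bullet> A u \<le> m * (u \<bullet> u)" and eq: "y \<bullet> A y = m * (y \<bullet> y)"
  shows "A y = m *\<^sub>R y"
proof -
  define r where "r = m *\<^sub>R y - A y"
  have "0 \<le> 2 * t * (r \<bullet> r) + t\<^sup>2 * (m * (r \<bullet> r) - r \<bullet> A r)" for t
  proof -
    have "A (y + t *\<^sub>R r) = A y + t *\<^sub>R A r"
      using lin by (simp add: linear_add linear_scale)
    then have "(y + t *\<^sub>R r) \<bullet> A (y + t *\<^sub>R r)
        = y \<bullet> A y + 2 * t * (r \<bullet> A y) + t\<^sup>2 * (r \<bullet> A r)"
      using sym[of y r] by (simp add: inner_add_left inner_add_right power2_eq_square algebra_simps)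
    moreover have "m * ((y + t *\<^sub>R r) \<bullet> (y + t *\<^sub>R r))
        = m * (y \<bullet> y) + 2 * t * (m * (r \<bullet> y)) + t\<^sup>2 * (m * (r \<bullet> r))"
      by (simp add: inner_add_left inner_add_right power2_eq_square algebra_simps inner_commute)
    moreover have "r \<bullet> r = m * (r \<bullet> y) - r \<bullet> A y"
      by (metis r_def inner_diff_right inner_scaleR_right)
    then have "2 * t * (r \<bullet> r) = 2 * t * (m * (r \<bullet> y)) - 2 * t * (r \<bullet> A y)"
      by (simp only: right_diff_distrib)
    ultimately show ?thesis
      using le[of "y + t *\<^sub>R r"] eq by (simp only: right_diff_distrib)
  qed
  then have "r \<bullet> r = 0"
    by (rule nonneg_quadratic_linear_coeff_zero)
  then show ?thesis
    by (simp add: r_def)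
qed

lemma compact_has_greatest:
  fixes S :: "real set"
  assumes "compact S" "S \<noteq> {}"
  shows "(GREATEST d. d \<in> S) \<in> S"
proof -
  obtain m where "m \<in> S" "\<And>d. d \<in> S \<Longrightarrow> d \<le> m"
    using compact_attains_sup[OF assms] by blast
  then show ?thesis
    by (rule GreatestI2_order)
qed

section \<open>The trilinear form of a tensor\<close>

lemma tensor_form_inner_yy: "tensor_form T x y y = x \<bullet> tensor_yy T y"
  by (simp add: tensor_form_def tensor_yy_def inner_vec_def sum_distrib_left mult_ac)

lemma tensor_form_inner_xy: "tensor_form T x y w = w \<bullet> tensor_xy T x y"
  by (simp add: tensor_form_def tensor_xy_def inner_vec_def sum_3 algebra_simps)

lemma tensor_form_commute:
  assumes "susceptibility_tensor T"
  shows "tensor_form T x y w = tensor_form T x w y"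
proof -
  have "T $ i $ j $ k = T $ i $ k $ j" for i j k
    using assms by (auto simp: susceptibility_tensor_def)
  then have "tensor_form T x y w = (\<Sum>i\<in>UNIV. \<Sum>j\<in>UNIV. \<Sum>k\<in>UNIV. T $ i $ k $ j * x $ i * y $ j * w $ k)"
    by (simp add: tensor_form_def)
  also have "\<dots> = (\<Sum>i\<in>UNIV. \<Sum>k\<in>UNIV. \<Sum>j\<in>UNIV. T $ i $ k $ j * x $ i * y $ j * w $ k)"
    by (intro sum.cong refl sum.swap)
  also have "\<dots> = tensor_form T x w y"
    by (simp add: tensor_form_def mult_ac)
  finally show ?thesis .
qed

lemma linear_tensor_xy: "linear (tensor_xy T x)"
  by (rule linearI)
    (simp_all add: tensor_xy_def vec_eq_iff sum.distrib sum_distrib_left algebra_simps)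

lemma tensor_form_scale:
  "tensor_form T x (c *\<^sub>R y) (c *\<^sub>R y) = c\<^sup>2 * tensor_form T x y y"
  by (simp add: tensor_form_def sum_distrib_left power2_eq_square mult_ac)

lemma continuous_on_tensor_form [continuous_intros]:
  assumes "continuous_on S f" "continuous_on S g" "continuous_on S h"
  shows "continuous_on S (\<lambda>s. tensor_form T (f s) (g s) (h s))"
  unfolding tensor_form_def by (intro continuous_intros assms)

section \<open>The largest C-eigenvalue as a maximum over unit vectors\<close>

lemma tensor_form_attains_max:
  obtains x y where "norm x = 1" "norm y = 1"
    "\<And>u w. norm u = 1 \<Longrightarrow> norm w = 1 \<Longrightarrow> tensor_form T u w w \<le> tensor_form T x y y"
proof -
  define S where "S = sphere (0::real^3) 1 \<times> sphere (0::real^3) 1"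
  have "compact S"
    unfolding S_def by (intro compact_Times compact_sphere)
  moreover have "S \<noteq> {}"
    by (simp add: S_def)
  moreover have "continuous_on S (\<lambda>p. tensor_form T (fst p) (snd p) (snd p))"
    by (intro continuous_intros)
  ultimately obtain p where "p \<in> S"
    "\<forall>q\<in>S. tensor_form T (fst q) (snd q) (snd q) \<le> tensor_form T (fst p) (snd p) (snd p)"
    using continuous_attains_sup by blast
  then show thesis
    using that[of "fst p" "snd p"] by (auto simp: S_def)
qed

lemma C_eigenvalue_of_maximizer:
  assumes T: "susceptibility_tensor T" and x: "norm x = 1" and y: "norm y = 1"
    and max: "\<And>u w. norm u = 1 \<Longrightarrow> norm w = 1 \<Longrightarrow> tensor_form T u w w \<le> tensor_form T x y y"
  shows "C_eigenvalue T (tensor_form T x y y)"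
proof -
  let ?m = "tensor_form T x y y"
  have "tensor_yy T y = ?m *\<^sub>R x"
    using linear_form_maximizer[OF x, of "tensor_yy T y"] max y
    by (simp add: tensor_form_inner_yy)
  moreover have "tensor_xy T x y = ?m *\<^sub>R y"
  proof (rule quadratic_form_maximizer[OF linear_tensor_xy])
    show "u \<bullet> tensor_xy T x w = w \<bullet> tensor_xy T x u" for u w
      using tensor_form_commute[OF T] by (simp flip: tensor_form_inner_xy)
    show "u \<bullet> tensor_xy T x u \<le> ?m * (u \<bullet> u)" for u
    proof (cases "u = 0")
      case False
      have "norm u *\<^sub>R sgn u = u"
        using False by (simp add: sgn_div_norm)
      then have "tensor_form T x u u = (norm u)\<^sup>2 * tensor_form T x (sgn u) (sgn u)"
        by (metis tensor_form_scale)
      also have "\<dots> \<le> (norm u)\<^sup>2 * ?m"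
        using max[OF x, of "sgn u"] False by (intro mult_left_mono) (auto simp: norm_sgn)
      finally show ?thesis
        by (simp add: tensor_form_inner_xy dot_square_norm mult.commute)
    qed simp
    show "y \<bullet> tensor_xy T x y = ?m * (y \<bullet> y)"
      using y by (simp add: dot_square_norm flip: tensor_form_inner_xy)
  qed
  ultimately show ?thesis
    unfolding C_eigenvalue_def using x y by (auto simp: norm_eq_1)
qed

lemma C_eigenvalue_imp_value:
  assumes "C_eigenvalue T l"
  obtains x y where "norm x = 1" "norm y = 1" "l = tensor_form T x y y"
  using assms by (auto simp: C_eigenvalue_def norm_eq_1 tensor_form_inner_yy)

lemma tensor_form_le_lambda_max:
  assumes T: "susceptibility_tensor T" and "norm u = 1" "norm w = 1"
  shows "tensor_form T u w w \<le> lambda_max T"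
proof -
  obtain x y where xy: "norm x = 1" "norm y = 1"
    "\<And>u w. norm u = 1 \<Longrightarrow> norm w = 1 \<Longrightarrow> tensor_form T u w w \<le> tensor_form T x y y"
    using tensor_form_attains_max by blast
  have "lambda_max T = tensor_form T x y y"
    unfolding lambda_max_def
  proof (rule Greatest_equality)
    show "C_eigenvalue T (tensor_form T x y y)"
      using C_eigenvalue_of_maximizer[OF T] xy by blast
    show "l \<le> tensor_form T x y y" if "C_eigenvalue T l" for l
      using that xy(3) by (metis C_eigenvalue_imp_value)
  qed
  then show ?thesis
    using xy(3) assms by simp
qed

section \<open>Polarization vectors and the effective coefficients\<close>

lemma norm_eq_1_vec3: "norm (v::real^3) = 1 \<longleftrightarrow> (v $ 1)\<^sup>2 + (v $ 2)\<^sup>2 + (v $ 3)\<^sup>2 = 1"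
  by (simp add: norm_eq_1 inner_vec_def sum_3 power2_eq_square)

lemma polarization_norm:
  assumes "polarization a z"
  shows "norm a = 1" "norm (extraordinary a z) = 1"
proof -
  show "norm a = 1"
    using assms by (simp add: norm_eq_1_vec3 polarization_def)
  have "(a $ 2 * z $ 1)\<^sup>2 + (- (a $ 1) * z $ 1)\<^sup>2 + (z $ 2)\<^sup>2
      = ((a $ 1)\<^sup>2 + (a $ 2)\<^sup>2) * (z $ 1)\<^sup>2 + (z $ 2)\<^sup>2"
    by (simp add: power2_eq_square algebra_simps)
  then show "norm (extraordinary a z) = 1"
    using assms by (simp add: norm_eq_1_vec3 polarization_def extraordinary_def)
qed

lemma compact_polarization: "compact {p. polarization (fst p) (snd p)}"
  (is "compact ?P")
proof (rule compact_eq_bounded_closed[THEN iffD2], rule conjI)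
  have "norm z = 1" if "polarization a z" for a and z :: "real^2"
    using that by (simp add: polarization_def norm_eq_1 inner_vec_def sum_2 power2_eq_square)
  then have "?P \<subseteq> sphere 0 1 \<times> sphere 0 1"
    using polarization_norm(1) by auto
  then show "bounded ?P"
    by (rule bounded_subset[rotated]) (intro bounded_Times bounded_sphere)
  show "closed ?P"
    unfolding polarization_def
    by (intro closed_Collect_conj closed_Collect_eq continuous_intros)
qed

lemma polarization_exists: "polarization (vector [1, 0, 0]) (vector [1, 0])"
  by (simp add: polarization_def)

lemma continuous_on_extraordinary:
  "continuous_on S (\<lambda>p. extraordinary (fst p) (snd p))"
proof -
  have "continuous_on S (\<lambda>p. extraordinary (fst p) (snd p) $ i)" for i
  proof -
    have "continuous_on S (\<lambda>p. extraordinary (fst p) (snd p) $ 1)"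
      "continuous_on S (\<lambda>p. extraordinary (fst p) (snd p) $ 2)"
      "continuous_on S (\<lambda>p. extraordinary (fst p) (snd p) $ 3)"
      unfolding extraordinary_def vector_3 by (intro continuous_intros)+
    then show ?thesis
      using exhaust_3[of i] by metis
  qed
  then have "continuous_on S (\<lambda>p. \<chi> i. extraordinary (fst p) (snd p) $ i)"
    by (rule continuous_on_vec_lambda)
  then show ?thesis
    by simp
qed

text \<open>
  Compactness of the set of admissible \<open>(a, z)\<close> ensures that a \<^const>\<open>Greatest\<close> over it is one of
  the values it ranges over.
\<close>

lemma greatest_over_polarization_attained:
  assumes "continuous_on UNIV (\<lambda>p. f (fst p) (snd p))"
  obtains a z where "polarization a z"
    "(GREATEST d. d \<in> {f a z | a z. polarization a z}) = (f a z :: real)"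
proof -
  let ?S = "{f a z | a z. polarization a z}"
  have "?S = (\<lambda>p. f (fst p) (snd p)) ` {p. polarization (fst p) (snd p)}"
    by (auto simp: image_def)
  moreover have "compact \<dots>"
    by (intro compact_continuous_image compact_polarization continuous_on_subset[OF assms]) auto
  ultimately have "compact ?S"
    by simp
  moreover have "?S \<noteq> {}"
    using polarization_exists by blast
  ultimately have "(GREATEST d. d \<in> ?S) \<in> ?S"
    by (rule compact_has_greatest)
  then show thesis
    using that by blast
qed

lemma d_eff1_attained:
  obtains a z where "polarization a z" "d_eff1 T = tensor_form T (extraordinary a z) a a"
  unfolding d_eff1_def
  by (rule greatest_over_polarization_attained
      [where f = "\<lambda>a z. tensor_form T (extraordinary a z) a a"])
    (auto intro!: continuous_intros continuous_on_extraordinary)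

lemma d_eff2_attained:
  obtains a z where "polarization a z"
    "d_eff2 T = tensor_form T a (extraordinary a z) (extraordinary a z)"
  unfolding d_eff2_def
  by (rule greatest_over_polarization_attained
      [where f = "\<lambda>a z. tensor_form T a (extraordinary a z) (extraordinary a z)"])
    (auto intro!: continuous_intros continuous_on_extraordinary)

section \<open>A tensor with strict inequalities\<close>

definition e333 :: "real^3^3^3" where
  "e333 = axis 3 (axis 3 (axis 3 1))"

lemma susceptibility_e333: "susceptibility_tensor e333"
  by (auto simp: susceptibility_tensor_def e333_def axis_def)

lemma tensor_form_e333: "tensor_form e333 x y w = x $ 3 * y $ 3 * w $ 3"
  by (simp add: tensor_form_def e333_def axis_def sum_3)

lemma lambda_max_e333: "1 \<le> lambda_max e333"
  using tensor_form_le_lambda_max[OF susceptibility_e333, of "axis 3 1" "axis 3 1"]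
  by (simp add: tensor_form_e333 norm_axis_1)

lemma d_eff_e333: "d_eff1 e333 = 0" "d_eff2 e333 = 0"
proof -
  show "d_eff1 e333 = 0"
    using d_eff1_attained[of e333] by (metis tensor_form_e333 polarization_def mult_zero_right)
  show "d_eff2 e333 = 0"
    using d_eff2_attained[of e333] by (metis tensor_form_e333 polarization_def mult_zero_left)
qed

section \<open>Comparison of the SHG coefficients with the largest C-eigenvalue\<close>

theorem theorem3p3:
  shows "(\<forall>T. susceptibility_tensor T \<longrightarrow> d_eff1 T \<le> lambda_max T \<and> d_eff2 T \<le> lambda_max T)
    \<and> (\<exists>T. susceptibility_tensor T \<and> d_eff1 T < lambda_max T)
    \<and> (\<exists>T. susceptibility_tensor T \<and> d_eff2 T < lambda_max T)"
proof (intro conjI allI impI)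
  fix T assume T: "susceptibility_tensor T"
  show "d_eff1 T \<le> lambda_max T"
    using d_eff1_attained[of T] tensor_form_le_lambda_max[OF T] polarization_norm by metis
  show "d_eff2 T \<le> lambda_max T"
    using d_eff2_attained[of T] tensor_form_le_lambda_max[OF T] polarization_norm by metis
next
  show "\<exists>T. susceptibility_tensor T \<and> d_eff1 T < lambda_max T"
    using susceptibility_e333 lambda_max_e333 d_eff_e333(1) by (intro exI[of _ e333]) simp
  show "\<exists>T. susceptibility_tensor T \<and> d_eff2 T < lambda_max T"
    using susceptibility_e333 lambda_max_e333 d_eff_e333(2) by (intro exI[of _ e333]) simp
qed

end
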